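(* Let $(D,V)$ be an admissible pair and $\mathcal{J}$ a closed $D$-invariant subspace of $C^\infty(D)$. Then $\sigma(D|_{\mathcal{J}})$ is either all of $\mathbb{C}$, or it equals the discrete (possibly empty) set $\{\lambda\in\mathbb{C}:\phi_\lambda\in\mathcal{J}\}$. If $\sigma(D|_{\mathcal{J}})\ne\mathbb{C},\emptyset$, then for each $\lambda\in\sigma(D|_{\mathcal{J}})$ the kernel of $(D-\lambda I)|_{\mathcal{J}}$ is one-dimensional (spanned by $\phi_\lambda$).
   Context: Let $H$ be a separable complex Hilbert space. A pair $(D,V)$ of operators is called admissible if: (i) $D:\mathscr{D}(D)\subset H\to H$ is a densely defined closed linear operator; (ii) $\dim\ker D=1$; (iii) $D$ has a self-adjoint restriction with compact resolvent; (iv) $V:H\to H$ is a compact operator with $\sigma(V)=\{0\}$; (v) $\operatorname{Ran}V\subset\mathscr{D}(D)$ and $DV=I$. Fix $0\neq\phi_0\in\ker D$ and put $\phi_\lambda=(I-\lambda V)^{-1}\phi_0$ for $\lambda\in\mathbb{C}$. Let $\mathscr{D}(D^1)=\mathscr{D}(D)$, $\mathscr{D}(D^n)=\{x\in\mathscr{D}(D^{n-1}):D^{n-1}x\in\mathscr{D}(D)\}$, and $C^\infty(D)=\bigcap_{n\ge1}\mathscr{D}(D^n)$, a Fréchet space with the metric $d(x,y)=\sum_{j\ge0}2^{-j}\frac{\|D^jx-D^jy\|_H}{1+\|D^jx-D^jy\|_H}$; $D$ acts continuously on $C^\infty(D)$. For a closed subspace $\mathcal{J}\subset C^\infty(D)$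 with $D\mathcal{J}\subset\mathcal{J}$, $\sigma(D|_{\mathcal{J}})$ is the set of $\lambda\in\mathbb{C}$ for which $(D-\lambda I)|_{\mathcal{J}}:\mathcal{J}\to\mathcal{J}$ is not bijective. *)

theory Defs
  imports "HOL-Analysis.Analysis"
begin

class complex_hilbert = banach +
  fixes cscale :: "complex \<Rightarrow> 'a \<Rightarrow> 'a"
    and cinner :: "'a \<Rightarrow> 'a \<Rightarrow> complex"
  assumes cscale_add_right: "cscale c (x + y) = cscale c x + cscale c y"
    and cscale_add_left: "cscale (a + b) x = cscale a x + cscale b x"
    and cscale_cscale: "cscale a (cscale b x) = cscale (a * b) x"
    and cscale_one: "cscale 1 x = x"
    and cscale_of_real: "cscale (of_real r) x = r *\<^sub>R x"
    and cinner_add_right: "cinner x (y + z) = cinner x y + cinner x z"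
    and cinner_scale_right: "cinner x (cscale c y) = c * cinner x y"
    and cinner_cnj_commute: "cinner y x = cnj (cinner x y)"
    and norm_eq_sqrt_cinner: "norm x = sqrt (Re (cinner x x))"

definition separable_type :: "'a::topological_space itself \<Rightarrow> bool" where
  "separable_type _ \<longleftrightarrow> (\<exists>S::'a set. countable S \<and> closure S = UNIV)"

definition csubspace :: "'a::complex_hilbert set \<Rightarrow> bool" where
  "csubspace S \<longleftrightarrow> 0 \<in> S \<and> (\<forall>x\<in>S. \<forall>y\<in>S. x + y \<in> S) \<and> (\<forall>c. \<forall>x\<in>S. cscale c x \<in> S)"

(* An (unbounded) operator is a pair of a domain dm and a function A
(whose values outside the domain are irrelevant). *)

definition clinear_on :: "'a::complex_hilbert set \<Rightarrow> ('a \<Rightarrow> 'a) \<Rightarrow> bool" where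
  "clinear_on dm A \<longleftrightarrow> csubspace dm \<and>
     (\<forall>x\<in>dm. \<forall>y\<in>dm. A (x + y) = A x + A y) \<and>
     (\<forall>c. \<forall>x\<in>dm. A (cscale c x) = cscale c (A x))"

definition densely_defined :: "'a::complex_hilbert set \<Rightarrow> ('a \<Rightarrow> 'a) \<Rightarrow> bool" where
  "densely_defined dm A \<longleftrightarrow> clinear_on dm A \<and> closure dm = UNIV"

definition closed_operator :: "'a::complex_hilbert set \<Rightarrow> ('a \<Rightarrow> 'a) \<Rightarrow> bool" where
  "closed_operator dm A \<longleftrightarrow> clinear_on dm A \<and> closed {(x, A x) | x. x \<in> dm}"

definition opker :: "'a::complex_hilbert set \<Rightarrow> ('a \<Rightarrow> 'a) \<Rightarrow> 'a set" where
  "opker dm A = {x \<in> dm. A x = 0}"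

definition cspan1 :: "'a::complex_hilbert \<Rightarrow> 'a set" where
  "cspan1 v = {cscale c v | c. True}"

definition cdim_one :: "'a::complex_hilbert set \<Rightarrow> bool" where
  "cdim_one S \<longleftrightarrow> (\<exists>v. v \<noteq> 0 \<and> S = cspan1 v)"

definition adjoint_dom :: "'a::complex_hilbert set \<Rightarrow> ('a \<Rightarrow> 'a) \<Rightarrow> 'a set" where
  "adjoint_dom dm A = {y. \<exists>z. \<forall>x\<in>dm. cinner (A x) y = cinner x z}"

definition self_adjoint_op :: "'a::complex_hilbert set \<Rightarrow> ('a \<Rightarrow> 'a) \<Rightarrow> bool" where
  "self_adjoint_op dm A \<longleftrightarrow> densely_defined dm A \<and>
     adjoint_dom dm A = dm \<and>
     (\<forall>x\<in>dm. \<forall>y\<in>dm. cinner (A x) y = cinner x (A y))"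

definition bounded_clinear_op :: "('a::complex_hilbert \<Rightarrow> 'a) \<Rightarrow> bool" where
  "bounded_clinear_op T \<longleftrightarrow> clinear_on UNIV T \<and> (\<exists>K. \<forall>x. norm (T x) \<le> K * norm x)"

definition compact_op :: "('a::complex_hilbert \<Rightarrow> 'a) \<Rightarrow> bool" where
  "compact_op T \<longleftrightarrow> bounded_clinear_op T \<and> compact (closure (T ` ball 0 1))"

definition compact_resolvent :: "'a::complex_hilbert set \<Rightarrow> ('a \<Rightarrow> 'a) \<Rightarrow> bool" where
  "compact_resolvent dm A \<longleftrightarrow> (\<exists>\<mu> R. compact_op R \<and> R ` UNIV \<subseteq> dm \<and>
     (\<forall>x. A (R x) - cscale \<mu> (R x) = x) \<and>
     (\<forall>y\<in>dm. R (A y - cscale \<mu> y) = y))"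

definition has_sa_restriction_compact_resolvent :: "'a::complex_hilbert set \<Rightarrow> ('a \<Rightarrow> 'a) \<Rightarrow> bool" where
  "has_sa_restriction_compact_resolvent dm A \<longleftrightarrow>
     (\<exists>dm'. dm' \<subseteq> dm \<and> self_adjoint_op dm' A \<and> compact_resolvent dm' A)"

definition bspectrum :: "('a::complex_hilbert \<Rightarrow> 'a) \<Rightarrow> complex set" where
  "bspectrum T = {l. \<not> bij (\<lambda>x. T x - cscale l x)}"

definition admissible :: "'a::complex_hilbert set \<Rightarrow> ('a \<Rightarrow> 'a) \<Rightarrow> ('a \<Rightarrow> 'a) \<Rightarrow> bool" where
  "admissible dm D V \<longleftrightarrow>
     densely_defined dm D \<and> closed_operator dm D \<and>
     cdim_one (opker dm D) \<and>
     has_sa_restriction_compact_resolvent dm D \<and>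
     compact_op V \<and> bspectrum V = {0} \<and>
     V ` UNIV \<subseteq> dm \<and> (\<forall>x. D (V x) = x)"

definition phi :: "('a::complex_hilbert \<Rightarrow> 'a) \<Rightarrow> 'a \<Rightarrow> complex \<Rightarrow> 'a" where
  "phi V \<phi>0 l = inv (\<lambda>x. x - cscale l (V x)) \<phi>0"

definition Cinf :: "'a::complex_hilbert set \<Rightarrow> ('a \<Rightarrow> 'a) \<Rightarrow> 'a set" where
  "Cinf dm D = {x. \<forall>n. (D ^^ n) x \<in> dm}"

definition frechet_dist :: "('a::complex_hilbert \<Rightarrow> 'a) \<Rightarrow> 'a \<Rightarrow> 'a \<Rightarrow> real" where
  "frechet_dist D x y =
     (\<Sum>j. (1/2) ^ j * (norm ((D ^^ j) x - (D ^^ j) y) / (1 + norm ((D ^^ j) x - (D ^^ j) y))))"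

definition Cinf_topology :: "'a::complex_hilbert set \<Rightarrow> ('a \<Rightarrow> 'a) \<Rightarrow> 'a topology" where
  "Cinf_topology dm D = Metric_space.mtopology (Cinf dm D) (frechet_dist D)"

definition closed_invariant_subspace ::
  "'a::complex_hilbert set \<Rightarrow> ('a \<Rightarrow> 'a) \<Rightarrow> 'a set \<Rightarrow> bool" where
  "closed_invariant_subspace dm D J \<longleftrightarrow>
     J \<subseteq> Cinf dm D \<and> csubspace J \<and> closedin (Cinf_topology dm D) J \<and> D ` J \<subseteq> J"

definition restr_spectrum :: "('a::complex_hilbert \<Rightarrow> 'a) \<Rightarrow> 'a set \<Rightarrow> complex set" where
  "restr_spectrum D J = {l. \<not> bij_betw (\<lambda>x. D x - cscale l x) J J}"

definition restr_kernel :: "('a::complex_hilbert \<Rightarrow> 'a) \<Rightarrow> 'a set \<Rightarrow> complex \<Rightarrow> 'a set" where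
  "restr_kernel D J l = {x \<in> J. D x - cscale l x = 0}"

end

theory Submission
  imports Defs
begin

text \<open>
  For every \<open>l\<close> the operator \<open>G l = V (I - l V)\<inverse>\<close> is a right inverse of \<open>D - l\<close>, so on \<open>C\<^sup>\<infinity>(D)\<close> every
  solution of \<open>D y - l y = x\<close> has the form \<open>G l x + c \<phi>\<^sub>l\<close>. Let \<open>Z\<close> be the set of \<open>l\<close> with \<open>\<phi>\<^sub>l \<in> J\<close>. If
  \<open>m\<close> is a limit point of \<open>Z\<close>, then difference quotients put all vectors \<open>(G m)\<^sup>i \<phi>\<^sub>m\<close> into \<open>J\<close>, hence
  also \<open>\<phi>\<^sub>l\<close> for \<open>l\<close> near \<open>m\<close> by power series expansion; the limit points of \<open>Z\<close> thus form a clopen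
  set, and \<open>Z\<close> is either the whole plane or without limit points. In the second case the complement of
  \<open>Z\<close> is connected, and it suffices that the set of \<open>l \<notin> Z\<close> for which \<open>D - l\<close> maps \<open>J\<close> onto \<open>J\<close> is
  relatively clopen. Both halves rest on the fact that the coefficient \<open>c\<close> of a solution in \<open>J\<close> is
  controlled by a seminorm of \<open>G l x\<close>, because \<open>\<phi>\<^sub>l\<close> has positive distance from \<open>J\<close> in some seminorm.
\<close>

section \<open>Elementary real inequalities\<close>

lemma mult_le_of_le_divide:
  fixes a c d :: real
  assumes "c \<noteq> 0 \<Longrightarrow> d \<le> a / c" "0 \<le> c" "0 \<le> a"
  shows "c * d \<le> a"
  using assms by (cases "c = 0") (auto simp: field_simps)

definition squash :: "real \<Rightarrow> real" where
  "squash t = t / (1 + t)"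

lemma squash_bounds: "0 \<le> t \<Longrightarrow> 0 \<le> squash t" "0 \<le> t \<Longrightarrow> squash t \<le> 1"
  by (simp_all add: squash_def divide_le_eq)

lemma squash_eq_0_iff: "0 \<le> t \<Longrightarrow> squash t = 0 \<longleftrightarrow> t = 0"
  by (auto simp: squash_def)

text \<open>Since t / (1 + t) is increasing, \<open>c\<close> may be replaced by
  \<open>a + b\<close>; after splitting the fraction, both denominators only shrink.\<close>

lemma squash_triangle:
  assumes "0 \<le> a" "0 \<le> b" "0 \<le> c" "c \<le> a + b"
  shows "squash c \<le> squash a + squash b"
proof -
  have "squash c \<le> (a + b) / (1 + (a + b))"
    using assms by (simp add: squash_def divide_le_eq le_divide_eq field_simps)
  also have "\<dots> = a / (1 + (a + b)) + b / (1 + (a + b))" by (simp add: add_divide_distrib)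
  also have "\<dots> \<le> squash a + squash b"
    unfolding squash_def using assms by (intro add_mono divide_left_mono) auto
  finally show ?thesis .
qed

lemma frechet_bound: "0 \<le> t \<Longrightarrow> norm ((1/2::real) ^ j * squash t) \<le> (1/2) ^ j"
  using squash_bounds[of t] by (simp add: norm_mult mult_left_le)

section \<open>Complex scalars and complex subspaces\<close>

interpretation cscale: vector_space "cscale :: complex \<Rightarrow> 'a \<Rightarrow> 'a::complex_hilbert"
  by unfold_locales (simp_all add: cscale_add_right cscale_add_left cscale_cscale cscale_one)

text \<open>Linearity holds in the second argument of \<open>cinner\<close>; conjugate symmetry
  extracts \<open>cnj c\<close> from the first one, and the two factors multiply to the squared
  modulus.\<close>

lemma norm_cscale: "norm (cscale c x) = norm c * norm (x::'a::complex_hilbert)"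
proof -
  have "cinner (cscale c x) (cscale c x) = (c * cnj c) * cinner x x"
    by (metis (no_types, lifting) cinner_cnj_commute cinner_scale_right complex_cnj_mult mult.assoc)
  also have "c * cnj c = complex_of_real ((norm c)\<^sup>2)"
    by (simp add: complex_mult_cnj cmod_power2)
  finally have "Re (cinner (cscale c x) (cscale c x)) = (norm c)\<^sup>2 * Re (cinner x x)"
    by simp
  then show ?thesis
    by (simp add: norm_eq_sqrt_cinner real_sqrt_mult)
qed

interpretation cscale: bounded_bilinear "cscale :: complex \<Rightarrow> 'a \<Rightarrow> 'a::complex_hilbert"
proof
  fix a b :: complex and x y :: 'a and r :: real
  show "cscale (a + b) x = cscale a x + cscale b x" "cscale a (x + y) = cscale a x + cscale a y"
    by (simp_all add: cscale_add_left cscale_add_right)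
  show "cscale (r *\<^sub>R a) x = r *\<^sub>R cscale a x" "cscale a (r *\<^sub>R x) = r *\<^sub>R cscale a x"
    by (simp_all add: scaleR_conv_of_real mult.commute flip: cscale_of_real)
  show "\<exists>K. \<forall>a (x::'a). norm (cscale a x) \<le> norm a * norm x * K"
    by (rule exI[of _ 1]) (simp add: norm_cscale)
qed

lemma csubspace_diff: "csubspace S \<Longrightarrow> x \<in> S \<Longrightarrow> y \<in> S \<Longrightarrow> x - y \<in> S"
  unfolding csubspace_def
  by (metis cscale.scale_minus_left cscale.scale_one diff_conv_add_uminus)

lemma csubspace_add: "csubspace S \<Longrightarrow> x \<in> S \<Longrightarrow> y \<in> S \<Longrightarrow> x + y \<in> S"
  and csubspace_cscale: "csubspace S \<Longrightarrow> x \<in> S \<Longrightarrow> cscale c x \<in> S"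
  and csubspace_0: "csubspace S \<Longrightarrow> 0 \<in> S"
  by (simp_all add: csubspace_def)

lemma csubspace_sum:
  assumes "csubspace S" "\<And>i. i \<in> I \<Longrightarrow> f i \<in> S"
  shows "sum f I \<in> S"
  using assms(2) by (induction I rule: infinite_finite_induct)
    (simp_all add: csubspace_0[OF assms(1)] csubspace_add[OF assms(1)])

section \<open>Closed operators and the Frechet space of smooth vectors\<close>

locale closed_unbounded_operator =
  fixes dm :: "'a::complex_hilbert set" and D :: "'a \<Rightarrow> 'a"
  assumes closed_op: "closed_operator dm D"
begin

abbreviation "E \<equiv> Cinf dm D"

lemma dm_subspace: "csubspace dm"
  and D_add: "x \<in> dm \<Longrightarrow> y \<in> dm \<Longrightarrow> D (x + y) = D x + D y"
  and D_cscale: "x \<in> dm \<Longrightarrow> D (cscale c x) = cscale c (D x)"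
  using closed_op by (simp_all add: closed_operator_def clinear_on_def)

lemma D_diff: "x \<in> dm \<Longrightarrow> y \<in> dm \<Longrightarrow> D (x - y) = D x - D y"
  using D_add[OF csubspace_diff[OF dm_subspace], of x y y] by simp

lemma D_0: "D 0 = 0"
  using D_diff[OF csubspace_0 csubspace_0] dm_subspace by simp

lemma D_closed:
  assumes "\<And>k. f k \<in> dm" "f \<longlonglongrightarrow> x" "(\<lambda>k. D (f k)) \<longlonglongrightarrow> y"
  shows "x \<in> dm" "D x = y"
proof -
  have "(x, y) \<in> {(x, D x) | x. x \<in> dm}"
  proof (rule closed_sequentially)
    show "closed {(x, D x) | x. x \<in> dm}"
      using closed_op by (simp add: closed_operator_def)
    show "(\<lambda>k. (f k, D (f k))) \<longlonglongrightarrow> (x, y)"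
      by (intro tendsto_Pair assms)
  qed (use assms(1) in blast)
  then show "x \<in> dm" "D x = y" by auto
qed

lemma Cinf_funpow_dm: "x \<in> E \<Longrightarrow> (D ^^ n) x \<in> dm"
  by (simp add: Cinf_def)

lemma Cinf_imp_dm: "x \<in> E \<Longrightarrow> x \<in> dm"
  using Cinf_funpow_dm[of x 0] by simp

lemma Cinf_D: "x \<in> E \<Longrightarrow> D x \<in> E"
  using Cinf_funpow_dm[of x "Suc _"] by (simp add: Cinf_def funpow_swap1)

lemma funpow_D_add: "x \<in> E \<Longrightarrow> y \<in> E \<Longrightarrow> (D ^^ n) (x + y) = (D ^^ n) x + (D ^^ n) y"
  by (induction n) (simp_all add: D_add Cinf_funpow_dm)

lemma funpow_D_cscale: "x \<in> E \<Longrightarrow> (D ^^ n) (cscale c x) = cscale c ((D ^^ n) x)"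
  by (induction n) (simp_all add: D_cscale Cinf_funpow_dm)

lemma Cinf_subspace: "csubspace E"
  unfolding csubspace_def
proof (intro conjI ballI allI)
  have "(D ^^ n) 0 = 0" for n by (induction n) (simp_all add: D_0)
  then show "0 \<in> E" by (simp add: Cinf_def csubspace_0 dm_subspace)
  show "x + y \<in> E" if "x \<in> E" "y \<in> E" for x y
    using funpow_D_add[OF that] Cinf_funpow_dm[OF that(1)] Cinf_funpow_dm[OF that(2)] csubspace_add[OF dm_subspace]
    by (simp add: Cinf_def)
  show "cscale c x \<in> E" if "x \<in> E" for c x
    using funpow_D_cscale[OF that] Cinf_funpow_dm[OF that] csubspace_cscale[OF dm_subspace]
    by (simp add: Cinf_def)
qed

lemma funpow_D_diff: "x \<in> E \<Longrightarrow> y \<in> E \<Longrightarrow> (D ^^ n) (x - y) = (D ^^ n) x - (D ^^ n) y"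
  using funpow_D_add[OF csubspace_diff[OF Cinf_subspace], of x y y] by simp

text \<open>The graph norm of order \<open>n\<close>. Summing all derivatives up to \<open>n\<close>
  makes the family increasing in \<open>n\<close>, so that one index can serve for all smaller
  ones.\<close>

definition seminorm :: "nat \<Rightarrow> 'a \<Rightarrow> real" where
  "seminorm n x = (\<Sum>j\<le>n. norm ((D ^^ j) x))"

lemma seminorm_nonneg: "0 \<le> seminorm n x"
  by (simp add: seminorm_def sum_nonneg)

lemma norm_le_seminorm: "j \<le> n \<Longrightarrow> norm ((D ^^ j) x) \<le> seminorm n x"
  unfolding seminorm_def by (rule member_le_sum) auto

lemma seminorm_add: "x \<in> E \<Longrightarrow> y \<in> E \<Longrightarrow> seminorm n (x + y) \<le> seminorm n x + seminorm n y"
  by (simp add: seminorm_def funpow_D_add sum_mono norm_triangle_ineq flip: sum.distrib)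

lemma seminorm_cscale: "x \<in> E \<Longrightarrow> seminorm n (cscale c x) = norm c * seminorm n x"
  by (simp add: seminorm_def funpow_D_cscale norm_cscale sum_distrib_left)

text \<open>Sequential convergence in the Frechet space, phrased without the metric. All terms are
  required to lie in \<open>E\<close>, where the powers of \<open>D\<close> are additive and
  homogeneous.\<close>

definition Cinf_tendsto :: "(nat \<Rightarrow> 'a) \<Rightarrow> 'a \<Rightarrow> bool" where
  "Cinf_tendsto f x \<longleftrightarrow> x \<in> E \<and> (\<forall>k. f k \<in> E) \<and> (\<forall>j. (\<lambda>k. (D ^^ j) (f k)) \<longlonglongrightarrow> (D ^^ j) x)"

lemma Cinf_tendsto_seminorm:
  assumes "Cinf_tendsto f x" shows "(\<lambda>k. seminorm n (f k - x)) \<longlonglongrightarrow> 0"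
proof -
  have "(\<lambda>k. norm ((D ^^ j) (f k) - (D ^^ j) x)) \<longlonglongrightarrow> 0" for j
    using assms unfolding Cinf_tendsto_def by (simp add: tendsto_norm_zero LIM_zero)
  moreover have "seminorm n (f k - x) = (\<Sum>j\<le>n. norm ((D ^^ j) (f k) - (D ^^ j) x))" for k
    using assms unfolding Cinf_tendsto_def seminorm_def by (simp add: funpow_D_diff)
  ultimately show ?thesis
    by (simp add: tendsto_null_sum)
qed

lemma Cinf_tendsto_iff:
  assumes "x \<in> E" "\<And>k. f k \<in> E"
  shows "Cinf_tendsto f x \<longleftrightarrow> (\<forall>n. (\<lambda>k. seminorm n (f k - x)) \<longlonglongrightarrow> 0)"
proof
  assume L: "\<forall>n. (\<lambda>k. seminorm n (f k - x)) \<longlonglongrightarrow> 0"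
  have "(\<lambda>k. (D ^^ j) (f k)) \<longlonglongrightarrow> (D ^^ j) x" for j
  proof (rule LIM_zero_cancel, rule Lim_null_comparison)
    show "(\<lambda>k. seminorm j (f k - x)) \<longlonglongrightarrow> 0" using L by blast
    show "\<forall>\<^sub>F k in sequentially. norm ((D ^^ j) (f k) - (D ^^ j) x) \<le> seminorm j (f k - x)"
      using norm_le_seminorm[of j j] assms by (simp flip: funpow_D_diff)
  qed
  then show "Cinf_tendsto f x" using assms by (simp add: Cinf_tendsto_def)
qed (use Cinf_tendsto_seminorm in blast)

lemma Cinf_tendsto_add: "Cinf_tendsto f x \<Longrightarrow> Cinf_tendsto g y \<Longrightarrow> Cinf_tendsto (\<lambda>k. f k + g k) (x + y)"
  unfolding Cinf_tendsto_def
  by (auto simp: funpow_D_add csubspace_add[OF Cinf_subspace] intro!: tendsto_add)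

lemma Cinf_tendsto_cscale: "Cinf_tendsto f x \<Longrightarrow> c \<longlonglongrightarrow> c' \<Longrightarrow> Cinf_tendsto (\<lambda>k. cscale (c k) (f k)) (cscale c' x)"
  unfolding Cinf_tendsto_def
  by (auto simp: funpow_D_cscale csubspace_cscale[OF Cinf_subspace] intro!: cscale.tendsto)

lemma Cinf_tendsto_const: "x \<in> E \<Longrightarrow> Cinf_tendsto (\<lambda>k. x) x"
  by (simp add: Cinf_tendsto_def)

lemma Cinf_tendsto_subseq: "Cinf_tendsto f x \<Longrightarrow> strict_mono r \<Longrightarrow> Cinf_tendsto (f \<circ> r) x"
  unfolding Cinf_tendsto_def using LIMSEQ_subseq_LIMSEQ[of _ _ r] by (fastforce simp: o_def)

lemma Cinf_tendsto_D: "Cinf_tendsto f x \<Longrightarrow> Cinf_tendsto (\<lambda>k. D (f k)) (D x)"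
proof -
  assume f: "Cinf_tendsto f x"
  then have "(\<lambda>k. (D ^^ Suc j) (f k)) \<longlonglongrightarrow> (D ^^ Suc j) x" for j
    unfolding Cinf_tendsto_def by blast
  with f show ?thesis by (simp add: Cinf_tendsto_def Cinf_D funpow_swap1)
qed

lemma Cinf_tendsto_unique: "Cinf_tendsto f x \<Longrightarrow> Cinf_tendsto f y \<Longrightarrow> x = y"
  unfolding Cinf_tendsto_def using LIMSEQ_unique[of f x y] by (metis (no_types, lifting) ext funpow_0)

text \<open>Closedness of \<open>D\<close> links the limits of consecutive derivatives:
  \<open>D\<close> sends the j-th limit to the next one. Hence they are the iterates of
  \<open>D\<close> on the limit of the sequence itself.\<close>

lemma Cinf_complete:
  assumes "\<And>k. f k \<in> E" "\<And>j. convergent (\<lambda>k. (D ^^ j) (f k))"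
  shows "\<exists>x. Cinf_tendsto f x"
proof -
  define x where "x j = lim (\<lambda>k. (D ^^ j) (f k))" for j
  have lim: "(\<lambda>k. (D ^^ j) (f k)) \<longlonglongrightarrow> x j" for j
    unfolding x_def using assms(2) by (simp add: convergent_LIMSEQ_iff)
  have step: "x j \<in> dm \<and> D (x j) = x (Suc j)" for j
    using D_closed[OF Cinf_funpow_dm[OF assms(1)] lim[of j]] lim[of "Suc j"] by simp
  have iter: "(D ^^ j) (x 0) = x j" for j
    by (induction j) (simp_all add: step)
  then have "x 0 \<in> E" using step by (simp add: Cinf_def)
  then show ?thesis using iter lim assms(1) by (auto simp: Cinf_tendsto_def)
qed

lemma frechet_dist_squash:
  "frechet_dist D x y = (\<Sum>j. (1/2) ^ j * squash (norm ((D ^^ j) x - (D ^^ j) y)))"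
  by (simp add: frechet_dist_def squash_def)

lemma frechet_summable:
  "summable (\<lambda>j. (1/2::real) ^ j * squash (norm ((D ^^ j) x - (D ^^ j) y)))"
  by (rule summable_comparison_test'[where N=0 and g="\<lambda>j. (1/2) ^ j"])
     (simp, rule frechet_bound, simp)

text \<open>Needed to give \<open>mtopology\<close> its usual meaning. The term with j = 0 already
  separates points, and the triangle inequality holds term by term.\<close>

lemma Metric_space_frechet: "Metric_space E (frechet_dist D)"
proof
  fix x y
  show "0 \<le> frechet_dist D x y"
    unfolding frechet_dist_squash by (intro suminf_nonneg frechet_summable) (simp add: squash_bounds)
  show "frechet_dist D x y = frechet_dist D y x"
    unfolding frechet_dist_def by (simp add: norm_minus_commute)
  show "frechet_dist D x y = 0 \<longleftrightarrow> x = y"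
  proof
    assume "frechet_dist D x y = 0"
    then have "\<forall>j. (1/2::real) ^ j * squash (norm ((D ^^ j) x - (D ^^ j) y)) = 0"
      unfolding frechet_dist_squash
      by (subst (asm) suminf_eq_zero_iff[OF frechet_summable]) (simp add: squash_bounds)
    from spec[OF this, of 0] show "x = y"
      by (simp add: squash_eq_0_iff)
  qed (simp add: frechet_dist_def)
next
  fix x y z
  have "(1/2) ^ j * squash (norm ((D ^^ j) x - (D ^^ j) z))
      \<le> (1/2) ^ j * squash (norm ((D ^^ j) x - (D ^^ j) y))
       + (1/2) ^ j * squash (norm ((D ^^ j) y - (D ^^ j) z))" for j
    unfolding distrib_left[symmetric]
    by (intro mult_left_mono squash_triangle) (simp_all, metis dist_norm dist_triangle)
  then show "frechet_dist D x z \<le> frechet_dist D x y + frechet_dist D y z"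
    unfolding frechet_dist_squash suminf_add[OF frechet_summable frechet_summable]
    by (intro suminf_le frechet_summable summable_add)
qed

text \<open>Each term of the metric series tends to 0, and a geometric majorant lets Tannery's
  theorem exchange limit and sum. This makes topological closedness usable for sequences.\<close>

lemma Cinf_tendsto_imp_limitin:
  assumes "Cinf_tendsto f x"
  shows "limitin (Cinf_topology dm D) f x sequentially"
proof -
  interpret M: Metric_space E "frechet_dist D" by (rule Metric_space_frechet)
  let ?a = "\<lambda>j k. (1/2) ^ j * squash (norm ((D ^^ j) (f k) - (D ^^ j) x))"
  have "((\<lambda>k. frechet_dist D (f k) x) \<longlongrightarrow> (\<Sum>j. (0::real))) sequentially"
    unfolding frechet_dist_squash
  proof (rule tannerys_theorem[THEN conjunct2, THEN conjunct2])
    fix j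
    have "(\<lambda>k. norm ((D ^^ j) (f k) - (D ^^ j) x)) \<longlonglongrightarrow> 0"
      using assms by (simp add: Cinf_tendsto_def tendsto_norm_zero LIM_zero)
    then have "?a j \<longlonglongrightarrow> (1/2) ^ j * (0 / (1 + 0))"
      unfolding squash_def by (intro tendsto_intros) auto
    then show "?a j \<longlonglongrightarrow> 0"
      by simp
  next
    have "norm (?a j k) \<le> (1/2) ^ j" for j k
      by (rule frechet_bound) simp
    then show "\<forall>\<^sub>F (j, k) in sequentially \<times>\<^sub>F sequentially. norm (?a j k) \<le> (1/2) ^ j"
      by (intro always_eventually) auto
  qed auto
  then show ?thesis
    using assms unfolding Cinf_topology_def M.limit_metric_sequentially Cinf_tendsto_def
    by (auto simp: tendsto_iff eventually_sequentially dist_real_def)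
qed

end

section \<open>Closed invariant subspaces\<close>

locale frechet_subspace = closed_unbounded_operator +
  fixes J
  assumes J: "closed_invariant_subspace dm D J"
begin

lemma J_subspace: "csubspace J" and J_Cinf: "x \<in> J \<Longrightarrow> x \<in> E" and J_D: "x \<in> J \<Longrightarrow> D x \<in> J"
  using J by (auto simp: closed_invariant_subspace_def)

lemma J_closed:
  assumes "Cinf_tendsto f x" "\<And>k. f k \<in> J" shows "x \<in> J"
  using limitin_closedin[OF Cinf_tendsto_imp_limitin[OF assms(1)], of J] J assms(2)
  by (simp add: closed_invariant_subspace_def)

text \<open>Otherwise \<open>J\<close> contains, for each \<open>k\<close>, a vector within 1 / (k +
  1) of \<open>x\<close> in the k-th seminorm. As the seminorms increase, these vectors converge to
  \<open>x\<close> in all of them, and closedness puts \<open>x\<close> into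
  \<open>J\<close>.\<close>

lemma J_distance:
  assumes "x \<in> E" "x \<notin> J"
  obtains n \<delta> where "\<delta> > 0" "\<And>y. y \<in> J \<Longrightarrow> \<delta> \<le> seminorm n (x - y)"
proof (rule ccontr)
  assume "\<not> thesis"
  then have "\<forall>k. \<exists>y\<in>J. seminorm k (y - x) < inverse (real (Suc k))"
  proof -
    have "seminorm k (y - x) = seminorm k (x - y)" if "y \<in> J" for k y
      using seminorm_cscale[of "y - x" k "-1"] that assms J_Cinf csubspace_diff[OF Cinf_subspace]
      by (simp add: cscale.scale_minus_left)
    then show ?thesis
      using \<open>\<not> thesis\<close> that by (metis inverse_positive_iff_positive not_le of_nat_0_less_iff zero_less_Suc)
  qed
  then obtain y where y: "\<And>k. y k \<in> J" "\<And>k. seminorm k (y k - x) < inverse (real (Suc k))"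
    by metis
  have mono: "seminorm n z \<le> seminorm k z" if "n \<le> k" for n k z
    unfolding seminorm_def using that by (intro sum_mono2) auto
  have "(\<lambda>k. seminorm n (y k - x)) \<longlonglongrightarrow> 0" for n
  proof (rule Lim_null_comparison)
    show "(\<lambda>k. inverse (real (Suc k))) \<longlonglongrightarrow> 0" by (rule LIMSEQ_inverse_real_of_nat)
    show "\<forall>\<^sub>F k in sequentially. norm (seminorm n (y k - x)) \<le> inverse (real (Suc k))"
      unfolding eventually_sequentially real_norm_def abs_of_nonneg[OF seminorm_nonneg]
      using y(2) mono by (meson less_imp_le order_trans)
  qed
  then have "Cinf_tendsto y x" using Cinf_tendsto_iff[of x y] assms y J_Cinf by blast
  then show False using J_closed y assms by blast
qed

end

section \<open>Admissible pairs and the resolvent of V\<close>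

locale admissible_pair =
  fixes dm :: "'a::complex_hilbert set" and D V :: "'a \<Rightarrow> 'a" and \<phi>0 :: 'a
  assumes adm: "admissible dm D V"
    and phi0: "\<phi>0 \<in> opker dm D" "\<phi>0 \<noteq> 0"

sublocale admissible_pair \<subseteq> closed_unbounded_operator
  using adm by unfold_locales (simp add: admissible_def)

context admissible_pair
begin

lemma V_dm: "V x \<in> dm" and D_V: "D (V x) = x"
  and V_compact: "compact (closure (V ` ball 0 1))"
  and V_add: "V (x + y) = V x + V y"
  and V_cscale: "V (cscale c x) = cscale c (V x)"
  using adm by (auto simp: admissible_def compact_op_def bounded_clinear_op_def clinear_on_def)

lemma V_bounded_linear: "bounded_linear V"
proof -
  obtain K where "\<And>x. norm (V x) \<le> K * norm x"
    using adm by (auto simp: admissible_def compact_op_def bounded_clinear_op_def)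
  then show ?thesis
    by (intro bounded_linear_intro[where K=K])
       (simp_all add: V_add V_cscale mult.commute flip: cscale_of_real)
qed

interpretation V: bounded_linear V by (rule V_bounded_linear)

text \<open>For nonzero \<open>l\<close> the map is \<open>- l\<close> times V - 1 / l, and 1 / l
  lies outside the spectrum of \<open>V\<close>.\<close>

lemma bij_resolvent: "bij (\<lambda>x. x - cscale l (V x))"
proof (cases "l = 0")
  case True
  then show ?thesis by (simp add: id_def[symmetric])
next
  case False
  have "1 / l \<notin> bspectrum V"
    using adm False by (simp add: admissible_def)
  then have 1: "bij (\<lambda>x. V x - cscale (1 / l) x)"
    by (simp add: bspectrum_def)
  have 2: "bij (cscale (- l) :: 'a \<Rightarrow> 'a)"
    by (rule o_bij[where g="cscale (- 1 / l)"]) (use False in \<open>simp_all add: fun_eq_iff\<close>)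
  have "(\<lambda>x. x - cscale l (V x)) = cscale (- l) \<circ> (\<lambda>x. V x - cscale (1 / l) x)"
    using False by (simp add: fun_eq_iff cscale.scale_right_diff_distrib)
  then show ?thesis using bij_comp[OF 1 2] by simp
qed

definition R :: "complex \<Rightarrow> 'a \<Rightarrow> 'a" where
  "R l = inv (\<lambda>x. x - cscale l (V x))"

abbreviation "\<phi> \<equiv> phi V \<phi>0"

lemma phi_R: "\<phi> l = R l \<phi>0"
  by (simp add: phi_def R_def)

lemma R_eq: "R l x - cscale l (V (R l x)) = x"
  unfolding R_def using surj_f_inv_f[OF bij_is_surj[OF bij_resolvent[of l]]] .

lemma resolvent_inj: "x - cscale l (V x) = y - cscale l (V y) \<Longrightarrow> x = y"
  by (rule injD[OF bij_is_inj[OF bij_resolvent[of l]]])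

lemma R_unique: "y - cscale l (V y) = x \<Longrightarrow> R l x = y"
  using R_eq resolvent_inj by metis

lemma R_add: "R l (x + y) = R l x + R l y"
proof (rule R_unique)
  have "R l x + R l y - cscale l (V (R l x + R l y))
      = (R l x - cscale l (V (R l x))) + (R l y - cscale l (V (R l y)))"
    by (simp add: V_add cscale_add_right)
  then show "R l x + R l y - cscale l (V (R l x + R l y)) = x + y"
    by (simp add: R_eq)
qed

lemma R_cscale: "R l (cscale c x) = cscale c (R l x)"
proof (rule R_unique)
  have "cscale c (R l x) - cscale l (V (cscale c (R l x))) = cscale c (R l x - cscale l (V (R l x)))"
    by (simp add: V_cscale cscale.scale_right_diff_distrib cscale_cscale mult.commute)
  then show "cscale c (R l x) - cscale l (V (cscale c (R l x))) = cscale c x"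
    by (simp add: R_eq)
qed

text \<open>Compactness of \<open>V\<close> is used only here; it replaces the open mapping theorem.\<close>

lemma resolvent_bounded_below: "\<exists>c>0. \<forall>x. c * norm x \<le> norm (x - cscale l (V x))"
proof (rule ccontr)
  assume "\<not> ?thesis"
  then have "\<exists>x. norm (x - cscale l (V x)) < inverse (real (Suc k)) * norm x" for k
    by (meson inverse_positive_iff_positive not_le of_nat_0_less_iff zero_less_Suc)
  then obtain x where x: "\<And>k. norm (x k - cscale l (V (x k))) < inverse (real (Suc k)) * norm (x k)"
    by metis
  have x0: "norm (x k) > 0" for k
    using x[of k] by (auto simp: V.zero)
  \<comment> \<open>The norm becomes 1 / 2 rather than 1, so that \<open>u k\<close> lies in the
    open unit ball, whose image has compact closure.\<close>
  define u where "u k = (1 / (2 * norm (x k))) *\<^sub>R x k" for k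
  have u: "norm (u k) = 1 / 2" for k
    using x0[of k] by (simp add: u_def)
  have eq: "u k - cscale l (V (u k)) = (1 / (2 * norm (x k))) *\<^sub>R (x k - cscale l (V (x k)))" for k
    by (simp add: u_def V.scaleR cscale.scaleR_right scaleR_right_diff_distrib)
  have "norm (u k - cscale l (V (u k))) \<le> inverse (real (Suc k))" for k
  proof -
    have "norm (u k - cscale l (V (u k))) = 1 / (2 * norm (x k)) * norm (x k - cscale l (V (x k)))"
      unfolding eq by simp
    also have "\<dots> \<le> 1 / (2 * norm (x k)) * (inverse (real (Suc k)) * norm (x k))"
      by (intro mult_left_mono less_imp_le[OF x]) simp
    also have "\<dots> = inverse (real (Suc k)) / 2" using x0[of k] by simp
    also have "\<dots> \<le> inverse (real (Suc k))" by simp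
    finally show ?thesis .
  qed
  then have lim0: "(\<lambda>k. u k - cscale l (V (u k))) \<longlonglongrightarrow> 0"
    by (intro Lim_null_comparison[OF always_eventually LIMSEQ_inverse_real_of_nat]) auto
  have "V (u k) \<in> closure (V ` ball 0 1)" for k
    by (intro subsetD[OF closure_subset] imageI) (simp add: u)
  then obtain z r where r: "strict_mono r" and z: "(\<lambda>k. V (u (r k))) \<longlonglongrightarrow> z"
    using seq_compactE[OF compact_imp_seq_compact[OF V_compact], of "\<lambda>k. V (u k)"]
    unfolding o_def by blast
  have lim0': "(\<lambda>k. u (r k) - cscale l (V (u (r k)))) \<longlonglongrightarrow> 0"
    using LIMSEQ_subseq_LIMSEQ[OF lim0 r] by (simp add: o_def)
  \<comment> \<open>\<open>u (r k)\<close> is a null sequence plus \<open>l\<close> times a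
    convergent one. The limit lies in the kernel of I - l V, yet it has norm 1 / 2.\<close>
  have ur: "(\<lambda>k. u (r k)) \<longlonglongrightarrow> cscale l z"
    using tendsto_add[OF lim0' cscale.tendsto[OF tendsto_const[of l] z]] by simp
  have "V (cscale l z) = z"
    using LIMSEQ_unique[OF V.tendsto[OF ur] z] .
  then have "cscale l z = 0"
    using resolvent_inj[of "cscale l z" l 0] by (simp add: V.zero)
  then have "norm (cscale l z) = 0" by (simp only: norm_zero)
  moreover have "norm (cscale l z) = 1 / 2"
    using tendsto_norm[OF ur] by (simp add: u LIMSEQ_const_iff)
  ultimately show False by linarith
qed

section \<open>Right inverses of D - l and eigenvectors of D\<close>

definition G :: "complex \<Rightarrow> 'a \<Rightarrow> 'a" where
  "G l x = V (R l x)"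

lemma G_dm: "G l x \<in> dm"
  by (simp add: G_def V_dm)

lemma D_G: "D (G l x) = x + cscale l (G l x)"
  using R_eq[of l x] by (simp add: G_def D_V algebra_simps)

lemma G_add: "G l (x + y) = G l x + G l y"
  by (simp add: G_def R_add V_add)

lemma G_cscale: "G l (cscale c x) = cscale c (G l x)"
  by (simp add: G_def R_cscale V_cscale)

lemma G_diff: "G l (x - y) = G l x - G l y"
  using G_add[of l "x - y" y] by simp

lemma G_bounded: "\<exists>K>0. \<forall>x. norm (G l x) \<le> K * norm x"
proof -
  obtain c where c: "c > 0" "\<And>x. c * norm x \<le> norm (x - cscale l (V x))"
    using resolvent_bounded_below by blast
  obtain K where K: "K > 0" "\<And>x. norm (V x) \<le> norm x * K"
    using V.pos_bounded by blast
  have "norm (G l x) \<le> (K / c) * norm x" for x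
  proof -
    have "norm (G l x) \<le> norm (R l x) * K" by (simp add: G_def K)
    also have "\<dots> \<le> (norm x / c) * K"
      using c(2)[of "R l x"] c(1) K(1) by (intro mult_right_mono) (simp_all add: R_eq pos_le_divide_eq mult.commute)
    finally show ?thesis by (simp add: mult.commute)
  qed
  then show ?thesis using c(1) K(1) by (intro exI[of _ "K / c"]) simp
qed

lemma G_shift: "G l x - cscale l (V (G l x)) = V x"
  unfolding G_def using arg_cong[OF R_eq[of l x], of V] by (simp add: V.diff V_cscale)

text \<open>The resolvent identity. It is checked after applying the injective map I - m V, under
  which \<open>G_shift\<close> reduces every occurrence of \<open>G m\<close> to
  \<open>V\<close>.\<close>

lemma G_resolvent: "G l x = G m x + cscale (l - m) (G m (G l x))"
proof (rule resolvent_inj[where l=m])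
    let ?y = "G m x + cscale (l - m) (G m (G l x))"
    have "?y - cscale m (V ?y) = (G m x - cscale m (V (G m x)))
        + cscale (l - m) (G m (G l x) - cscale m (V (G m (G l x))))"
      by (simp add: V_add V_cscale cscale_add_right cscale.scale_right_diff_distrib cscale_cscale mult.commute)
    also have "\<dots> = V x + cscale (l - m) (V (G l x))"
      by (simp add: G_shift)
    also have "\<dots> = G l x - cscale m (V (G l x))"
      using G_shift[of l x] by (simp add: cscale.scale_left_diff_distrib algebra_simps)
    finally show "G l x - cscale m (V (G l x)) = ?y - cscale m (V ?y)" ..
qed

text \<open>The counterpart of \<open>G_resolvent\<close> for the eigenvectors. It serves three
  times: for continuity in \<open>l\<close>, for difference quotients, and, iterated, as a Taylor
  expansion with exact remainder.\<close>

lemma phi_resolvent: "\<phi> l = \<phi> m + cscale (l - m) (G m (\<phi> l))"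
proof (rule resolvent_inj[where l=m])
  let ?y = "\<phi> m + cscale (l - m) (G m (\<phi> l))"
  have "?y - cscale m (V ?y) = (\<phi> m - cscale m (V (\<phi> m)))
      + cscale (l - m) (G m (\<phi> l) - cscale m (V (G m (\<phi> l))))"
    by (simp add: V_add V_cscale cscale_add_right cscale.scale_right_diff_distrib cscale_cscale mult.commute)
  also have "\<dots> = \<phi>0 + cscale (l - m) (V (\<phi> l))"
    by (simp add: G_shift phi_R R_eq)
  also have "\<dots> = \<phi> l - cscale m (V (\<phi> l))"
    using R_eq[of l \<phi>0] by (simp add: phi_R cscale.scale_left_diff_distrib algebra_simps)
  finally show "\<phi> l - cscale m (V (\<phi> l)) = ?y - cscale m (V ?y)" ..
qed

lemma phi_neq_0: "\<phi> l \<noteq> 0"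
  using R_eq[of l \<phi>0] phi0(2) by (auto simp: phi_R V.zero)

lemma phi_dm: "\<phi> l \<in> dm" and D_phi: "D (\<phi> l) = cscale l (\<phi> l)"
proof -
  have eq: "\<phi> l = \<phi>0 + cscale l (V (\<phi> l))"
    using R_eq[of l \<phi>0] by (simp add: phi_R algebra_simps)
  have dm: "\<phi>0 \<in> dm" "cscale l (V (\<phi> l)) \<in> dm" "D \<phi>0 = 0"
    using phi0 by (auto simp: opker_def intro: csubspace_cscale dm_subspace V_dm)
  show "\<phi> l \<in> dm" by (subst eq) (intro csubspace_add dm_subspace dm)
  show "D (\<phi> l) = cscale l (\<phi> l)"
    by (subst eq) (simp add: D_add dm D_cscale V_dm D_V)
qed

lemma funpow_D_phi: "(D ^^ j) (\<phi> l) = cscale (l ^ j) (\<phi> l)"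
  by (induction j) (simp_all add: D_cscale phi_dm D_phi cscale_cscale mult.commute)

lemma phi_Cinf: "\<phi> l \<in> E"
  by (simp add: Cinf_def funpow_D_phi csubspace_cscale dm_subspace phi_dm)

text \<open>\<open>D\<close> annihilates x - l V x, because D V = I and D x = l x. As the kernel of
  \<open>D\<close> is one-dimensional, this vector is a multiple of \<open>\<phi>0\<close>, and
  \<open>R l\<close> recovers \<open>x\<close> from it.\<close>

lemma eigenvector:
  assumes "x \<in> dm" "D x = cscale l x" obtains c where "x = cscale c (\<phi> l)"
proof -
  obtain v where v: "opker dm D = cspan1 v"
    using adm by (auto simp: admissible_def cdim_one_def)
  obtain a where a: "\<phi>0 = cscale a v" using phi0(1) v by (auto simp: cspan1_def)
  have "a \<noteq> 0" using a phi0(2) by auto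
  have "x - cscale l (V x) \<in> opker dm D"
    using assms by (simp add: opker_def csubspace_diff csubspace_cscale dm_subspace V_dm D_diff D_cscale D_V)
  then obtain b where "x - cscale l (V x) = cscale b v" using v by (auto simp: cspan1_def)
  also have "\<dots> = cscale (b / a) \<phi>0" using a \<open>a \<noteq> 0\<close> by (simp add: cscale_cscale)
  finally have "x = cscale (b / a) (\<phi> l)"
    using R_unique R_cscale by (metis phi_R)
  then show thesis by (rule that)
qed

lemma funpow_D_G:
  assumes "x \<in> E"
  shows "(D ^^ n) (G l x) \<in> dm" "(D ^^ Suc n) (G l x) = (D ^^ n) x + cscale l ((D ^^ n) (G l x))"
proof -
  have "(D ^^ n) (G l x) \<in> dm \<and> (D ^^ Suc n) (G l x) = (D ^^ n) x + cscale l ((D ^^ n) (G l x))"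
  proof (induction n)
    case 0
    then show ?case by (simp add: G_dm D_G)
  next
    case (Suc n)
    then show ?case
      using Cinf_funpow_dm[OF assms, of n]
      by (auto simp: D_add D_cscale csubspace_cscale dm_subspace intro!: csubspace_add)
  qed
  then show "(D ^^ n) (G l x) \<in> dm" "(D ^^ Suc n) (G l x) = (D ^^ n) x + cscale l ((D ^^ n) (G l x))"
    by auto
qed

lemma G_Cinf: "x \<in> E \<Longrightarrow> G l x \<in> E"
  using funpow_D_G(1) by (simp add: Cinf_def)

lemma G_pow_add: "(G l ^^ i) (x + y) = (G l ^^ i) x + (G l ^^ i) y"
  and G_pow_diff: "(G l ^^ i) (x - y) = (G l ^^ i) x - (G l ^^ i) y"
  and G_pow_cscale: "(G l ^^ i) (cscale c x) = cscale c ((G l ^^ i) x)"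
  by (induction i) (simp_all add: G_add G_diff G_cscale)

lemma G_pow_Cinf: "x \<in> E \<Longrightarrow> (G l ^^ i) x \<in> E"
  by (induction i) (simp_all add: G_Cinf)

text \<open>By \<open>funpow_D_G\<close> the derivative of order n + 1 of \<open>G l x\<close> is
  controlled by those of order \<open>n\<close> of \<open>x\<close> and \<open>G l x\<close>. So the
  Hilbert norm bound propagates to every order.\<close>

lemma seminorm_G: "\<exists>C\<ge>0. \<forall>x\<in>E. seminorm n (G l x) \<le> C * seminorm n x"
proof (induction n)
  case 0
  obtain K where "K > 0" "\<And>x. norm (G l x) \<le> K * norm x" using G_bounded by blast
  then show ?case by (intro exI[of _ K]) (simp add: seminorm_def)
next
  case (Suc n)
  then obtain C where C: "C \<ge> 0" "\<And>x. x \<in> E \<Longrightarrow> seminorm n (G l x) \<le> C * seminorm n x" by blast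
  have seminorm_Suc: "seminorm (Suc n) x = seminorm n x + norm ((D ^^ Suc n) x)" for x by (simp add: seminorm_def)
  have "seminorm (Suc n) (G l x) \<le> (C + 1 + norm l * C) * seminorm (Suc n) x" if x: "x \<in> E" for x
  proof -
    have "norm ((D ^^ Suc n) (G l x)) \<le> norm ((D ^^ n) x) + norm l * norm ((D ^^ n) (G l x))"
      unfolding funpow_D_G(2)[OF x] by (rule norm_triangle_le) (simp add: norm_cscale)
    also have "\<dots> \<le> seminorm n x + norm l * (C * seminorm n x)"
      using norm_le_seminorm[of n n] C(2)[OF x] by (intro add_mono mult_left_mono) (auto intro: order_trans)
    finally have "seminorm (Suc n) (G l x) \<le> (C + 1 + norm l * C) * seminorm n x"
      using C(2)[OF x] by (simp add: seminorm_Suc algebra_simps)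
    also have "\<dots> \<le> (C + 1 + norm l * C) * seminorm (Suc n) x"
      using C(1) by (intro mult_left_mono) (auto simp: seminorm_Suc)
    finally show ?thesis .
  qed
  then show ?case using C(1) by (intro exI[of _ "C + 1 + norm l * C"]) auto
qed

lemma Cinf_tendsto_G:
  assumes "Cinf_tendsto f x" shows "Cinf_tendsto (\<lambda>k. G l (f k)) (G l x)"
proof -
  have E: "x \<in> E" "\<And>k. f k \<in> E" using assms by (auto simp: Cinf_tendsto_def)
  have "(\<lambda>k. seminorm n (G l (f k) - G l x)) \<longlonglongrightarrow> 0" for n
  proof -
    obtain C where C: "C \<ge> 0" "\<And>x. x \<in> E \<Longrightarrow> seminorm n (G l x) \<le> C * seminorm n x" using seminorm_G by blast
    show ?thesis
    proof (rule Lim_null_comparison)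
      show "(\<lambda>k. C * seminorm n (f k - x)) \<longlonglongrightarrow> 0"
        using tendsto_mult_left[OF Cinf_tendsto_seminorm[OF assms, of n], of C] by simp
      show "\<forall>\<^sub>F k in sequentially. norm (seminorm n (G l (f k) - G l x)) \<le> C * seminorm n (f k - x)"
        using C(2) E by (simp add: seminorm_nonneg csubspace_diff Cinf_subspace flip: G_diff)
    qed
  qed
  then show ?thesis using E by (simp add: Cinf_tendsto_iff G_Cinf)
qed

text \<open>Once |l k - m| < 1 / (2 K), half the norm of \<open>y k\<close> can be absorbed, which
  bounds it by twice the norm of \<open>z\<close>. Then y k - z is of order |l k - m|.\<close>

lemma resolvent_tendsto:
  assumes "l \<longlonglongrightarrow> m" "\<And>k. y k = z + cscale (l k - m) (G m (y k))"
  shows "y \<longlonglongrightarrow> z"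
proof -
  obtain K where K: "K > 0" "\<And>x. norm (G m x) \<le> K * norm x" using G_bounded by blast
  have l0: "(\<lambda>k. norm (l k - m)) \<longlonglongrightarrow> 0"
    using assms(1) by (simp add: tendsto_norm_zero LIM_zero)
  have "\<forall>\<^sub>F k in sequentially. norm (l k - m) < 1 / (2 * K)"
    using l0 K(1) by (intro order_tendstoD) auto
  then have "\<forall>\<^sub>F k in sequentially. norm (y k - z) \<le> norm (l k - m) * (K * (2 * norm z))"
  proof eventually_elim
    case (elim k)
    have d: "norm (y k - z) \<le> norm (l k - m) * (K * norm (y k))"
      by (subst assms(2)) (simp add: norm_cscale mult_left_mono K)
    also have "\<dots> \<le> 1 / (2 * K) * (K * norm (y k))"
      using elim K(1) by (intro mult_right_mono) auto
    also have "\<dots> = norm (y k) / 2" using K(1) by simp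
    finally have "norm (y k) \<le> 2 * norm z"
      using norm_triangle_ineq2[of "y k" z] by simp
    then have "norm (l k - m) * (K * norm (y k)) \<le> norm (l k - m) * (K * (2 * norm z))"
      using K(1) by (intro mult_left_mono) auto
    with d show ?case by simp
  qed
  moreover have "(\<lambda>k. norm (l k - m) * (K * (2 * norm z))) \<longlonglongrightarrow> 0"
    using tendsto_mult_right[OF l0] by simp
  ultimately show ?thesis by (rule LIM_zero_cancel[OF Lim_null_comparison])
qed

lemma Cinf_tendsto_phi: "l \<longlonglongrightarrow> m \<Longrightarrow> Cinf_tendsto (\<lambda>k. \<phi> (l k)) (\<phi> m)"
  using resolvent_tendsto[OF _ phi_resolvent, of l m]
  by (simp add: Cinf_tendsto_def funpow_D_phi phi_Cinf cscale.tendsto tendsto_power)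

text \<open>The resolvent identity settles convergence in the Hilbert norm;
  \<open>funpow_D_G\<close> passes it from each derivative to the next.\<close>

lemma Cinf_tendsto_G_param:
  assumes "l \<longlonglongrightarrow> m" "x \<in> E" shows "Cinf_tendsto (\<lambda>k. G (l k) x) (G m x)"
proof -
  have "(\<lambda>k. (D ^^ j) (G (l k) x)) \<longlonglongrightarrow> (D ^^ j) (G m x)" for j
  proof (induction j)
    case 0
    then show ?case using resolvent_tendsto[OF assms(1) G_resolvent] by simp
  next
    case (Suc j)
    then show ?case unfolding funpow_D_G(2)[OF assms(2)]
      by (intro tendsto_intros cscale.tendsto assms)
  qed
  then show ?thesis using assms by (simp add: Cinf_tendsto_def G_Cinf)
qed

end

section \<open>The set of parameters whose eigenvector lies in J\<close>

locale admissible_subspace = admissible_pair dm D V \<phi>0 + frechet_subspace dm D J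
  for dm :: "'a::complex_hilbert set" and D V \<phi>0 J
begin

definition Z :: "complex set" where
  "Z = {l. \<phi> l \<in> J}"

lemma islimpt_Z_ball:
  assumes "m islimpt Z"
  shows "\<exists>e>0. ball m e \<subseteq> Z"
proof -
  obtain l where l: "\<And>k. l k \<in> Z - {m}" "l \<longlonglongrightarrow> m"
    using assms by (auto simp: islimpt_sequential)
  \<comment> \<open>\<open>G m \<phi>\<^bsub>l k\<^esub>\<close> is the difference quotient of \<open>\<phi>\<close> between \<open>m\<close> and \<open>l k\<close>.\<close>
  have pow: "(\<forall>k. ((G m ^^ i) (\<phi> (l k))) \<in> J) \<and> (G m ^^ i) (\<phi> m) \<in> J
      \<and> Cinf_tendsto (\<lambda>k. (G m ^^ i) (\<phi> (l k))) ((G m ^^ i) (\<phi> m))" for i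
  proof (induction i)
    case 0
    then show ?case
      using l Cinf_tendsto_phi[OF l(2)] J_closed[OF Cinf_tendsto_phi[OF l(2)]] by (auto simp: Z_def)
  next
    case (Suc i)
    have "(G m ^^ Suc i) (\<phi> (l k)) \<in> J" for k
    proof -
      have lk: "l k - m \<noteq> 0" using l(1)[of k] by auto
      have "\<phi> (l k) - \<phi> m = cscale (l k - m) (G m (\<phi> (l k)))"
        by (metis phi_resolvent add_diff_cancel_left')
      then have "G m (\<phi> (l k)) = cscale (1 / (l k - m)) (\<phi> (l k) - \<phi> m)"
        using lk by simp
      then have "(G m ^^ Suc i) (\<phi> (l k))
          = cscale (1 / (l k - m)) ((G m ^^ i) (\<phi> (l k)) - (G m ^^ i) (\<phi> m))"
        by (simp only: funpow_Suc_right o_apply G_pow_cscale G_pow_diff)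
      then show ?thesis using Suc by (simp add: csubspace_cscale csubspace_diff J_subspace)
    qed
    moreover have "Cinf_tendsto (\<lambda>k. (G m ^^ Suc i) (\<phi> (l k))) ((G m ^^ Suc i) (\<phi> m))"
      using Suc Cinf_tendsto_G by simp
    ultimately show ?case using J_closed by blast
  qed
  obtain K where K: "K > 0" "\<And>x. norm (G m x) \<le> K * norm x" using G_bounded by blast
  \<comment> \<open>As \<open>K\<close> bounds \<open>G m\<close>, the Taylor series of
    \<open>\<phi>\<close> at \<open>m\<close> converges for |a - m| < 1 / K. Below,
    \<open>p N\<close> is its partial sum and \<open>w N\<close> the exact remainder.\<close>
  have "a \<in> Z" if a: "a \<in> ball m (1 / K)" for a
  proof -
    define w where "w i = cscale ((a - m) ^ i) ((G m ^^ i) (\<phi> a))" for i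
    define p where "p N = (\<Sum>i<N. cscale ((a - m) ^ i) ((G m ^^ i) (\<phi> m)))" for N
    have w_Suc: "w (Suc i) = cscale (a - m) (G m (w i))" for i
      by (simp add: w_def G_cscale cscale_cscale)
    have wE: "w i \<in> E" for i
      by (simp add: w_def csubspace_cscale Cinf_subspace G_pow_Cinf phi_Cinf)
    have remainder: "\<phi> a = p N + w N" for N
    proof (induction N)
      case 0
      show ?case by (simp add: p_def w_def)
    next
      case (Suc N)
      have "(G m ^^ N) (\<phi> a) = (G m ^^ N) (\<phi> m) + cscale (a - m) ((G m ^^ Suc N) (\<phi> a))"
        by (subst phi_resolvent[of a m]) (simp add: G_pow_add G_pow_cscale funpow_swap1)
      then have "w N = cscale ((a - m) ^ N) ((G m ^^ N) (\<phi> m)) + w (Suc N)"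
        unfolding w_def
        by (metis (no_types, lifting) cscale_add_right cscale_cscale mult.commute power_Suc)
      then show ?case using Suc by (simp add: p_def)
    qed
    have "norm (a - m) < 1 / K" using a by (simp add: dist_norm norm_minus_commute)
    then have q: "norm (a - m) * K < 1" using K(1) by (simp add: pos_less_divide_eq)
    have w_bound: "norm (w i) \<le> (norm (a - m) * K) ^ i * norm (\<phi> a)" for i
    proof (induction i)
      case 0
      show ?case by (simp add: w_def)
    next
      case (Suc i)
      have "norm (w (Suc i)) \<le> norm (a - m) * (K * norm (w i))"
        by (simp add: w_Suc norm_cscale mult_left_mono K)
      also have "\<dots> \<le> norm (a - m) * (K * ((norm (a - m) * K) ^ i * norm (\<phi> a)))"
        using K(1) by (intro mult_left_mono Suc) auto
      finally show ?case by (simp add: mult_ac)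
    qed
    \<comment> \<open>The geometric bound concerns the Hilbert norm only. Higher derivatives follow
      because \<open>D\<close> maps \<open>w (Suc i)\<close> to a combination of \<open>w i\<close>
      and \<open>w (Suc i)\<close>.\<close>
    have "(\<lambda>i. (D ^^ j) (w i)) \<longlonglongrightarrow> 0" for j
    proof (induction j)
      case 0
      have "(\<lambda>i. (norm (a - m) * K) ^ i * norm (\<phi> a)) \<longlonglongrightarrow> 0"
        using q K(1) by (intro tendsto_mult_left_zero LIMSEQ_power_zero) simp
      then have "w \<longlonglongrightarrow> 0"
        by (rule Lim_null_comparison[OF always_eventually, rotated]) (simp add: w_bound)
      then show ?case by simp
    next
      case (Suc j)
      have "(D ^^ Suc j) (w (Suc i)) = cscale (a - m) ((D ^^ j) (w i)) + cscale m ((D ^^ j) (w (Suc i)))" for i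
        unfolding w_Suc funpow_D_cscale[OF G_Cinf[OF wE]] funpow_D_G(2)[OF wE]
        by (simp add: cscale_add_right cscale_cscale mult.commute)
      moreover have "(\<lambda>i. cscale (a - m) ((D ^^ j) (w i)) + cscale m ((D ^^ j) (w (Suc i)))) \<longlonglongrightarrow>
          cscale (a - m) 0 + cscale m 0"
        by (intro tendsto_add cscale.tendsto tendsto_const Suc LIMSEQ_Suc[OF Suc])
      ultimately show ?case by (intro LIMSEQ_imp_Suc[of "\<lambda>i. (D ^^ Suc j) (w i)"]) (simp only: cscale.scale_zero_right add_0)
    qed
    moreover have "(D ^^ j) 0 = 0" for j
      by (induction j) (simp_all add: D_0)
    ultimately have "Cinf_tendsto w 0"
      using wE csubspace_0[OF Cinf_subspace] by (simp add: Cinf_tendsto_def)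
    from Cinf_tendsto_add[OF Cinf_tendsto_const[OF phi_Cinf[of a]] Cinf_tendsto_cscale[OF this tendsto_const[of "-1"]]]
    have "Cinf_tendsto (\<lambda>i. \<phi> a - w i) (\<phi> a)"
      by (simp add: cscale.scale_minus_left)
    moreover have "\<phi> a - w i = p i" for i
      using remainder[of i] by simp
    moreover have "p i \<in> J" for i
      unfolding p_def using pow by (intro csubspace_sum csubspace_cscale J_subspace) blast
    ultimately show ?thesis using J_closed by (simp add: Z_def)
  qed
  then show ?thesis using K(1) by (intro exI[of _ "1 / K"]) auto
qed

lemma Z_dichotomy: "Z = UNIV \<or> Z sparse_in UNIV"
proof -
  define L where "L = {m. m islimpt Z}"
  have "open L"
    unfolding open_contains_ball
  proof
    fix m assume "m \<in> L"
    then obtain e where e: "e > 0" "ball m e \<subseteq> Z" using islimpt_Z_ball by (auto simp: L_def)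
    \<comment> \<open>Interior points of \<open>Z\<close> are limit points, since the plane has no
      isolated points.\<close>
    have "a islimpt Z" if "a \<in> ball m e" for a
      using interior_limit_point[of a Z] that interior_maximal[OF e(2)] by auto
    then show "\<exists>e>0. ball m e \<subseteq> L" using e(1) by (auto simp: L_def)
  qed
  moreover have "closed L" unfolding L_def by (rule closed_limpts)
  ultimately consider "L = {}" | "L = UNIV" using clopen by blast
  then show ?thesis
  proof cases
    case 1
    then show ?thesis by (auto simp: L_def sparse_in_def)
  next
    case 2
    have "m \<in> Z" for m
    proof -
      have "m islimpt Z" using 2 by (auto simp: L_def)
      from islimpt_Z_ball[OF this] show ?thesis by auto
    qed
    then show ?thesis by blast
  qed
qed

section \<open>Surjectivity of D - l on J\<close>

definition onto_shift :: "complex \<Rightarrow> bool" where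
  "onto_shift l \<longleftrightarrow> (\<forall>x\<in>J. \<exists>y\<in>J. D y = x + cscale l y)"

lemma kernel_trivial:
  assumes "l \<notin> Z" "x \<in> J" "D x = cscale l x" shows "x = 0"
proof (rule ccontr)
  assume "x \<noteq> 0"
  obtain c where c: "x = cscale c (\<phi> l)"
    using eigenvector[OF Cinf_imp_dm[OF J_Cinf]] assms by metis
  then have "\<phi> l = cscale (1 / c) x" using \<open>x \<noteq> 0\<close> by auto
  then show False using assms csubspace_cscale[OF J_subspace] by (simp add: Z_def)
qed

text \<open>A Neumann series perturbs the inverse \<open>S\<close> of D - l on \<open>J\<close>. The
  distance of \<open>\<phi> l\<close> from \<open>J\<close> yields a bound for \<open>S\<close> in a
  single seminorm, which suffices to start the convergence.\<close>

lemma onto_shift_open: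
  assumes l: "l \<notin> Z" and onto: "onto_shift l"
  shows "\<exists>e>0. \<forall>m\<in>ball l e. onto_shift m"
proof -
  obtain S where S: "\<And>x. x \<in> J \<Longrightarrow> S x \<in> J" "\<And>x. x \<in> J \<Longrightarrow> D (S x) = x + cscale l (S x)"
    using onto unfolding onto_shift_def by metis
  \<comment> \<open>\<open>S\<close> is chosen pointwise; its additivity comes from uniqueness of
    solutions in \<open>J\<close>.\<close>
  have S_diff: "S x - S y = S (x - y)" if "x \<in> J" "y \<in> J" for x y
  proof -
    have xy: "x - y \<in> J" and dJ: "S x - S y \<in> J" using that S(1) by (simp_all add: csubspace_diff J_subspace)
    have "S x - S y - S (x - y) = 0"
    proof (rule kernel_trivial[OF l])
      show "S x - S y - S (x - y) \<in> J" by (intro csubspace_diff J_subspace S that)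
      show "D (S x - S y - S (x - y)) = cscale l (S x - S y - S (x - y))"
        using that xy dJ by (simp add: D_diff Cinf_imp_dm J_Cinf S cscale.scale_right_diff_distrib)
    qed
    then show ?thesis by simp
  qed
  obtain n \<delta> where \<delta>: "\<delta> > 0" "\<And>y. y \<in> J \<Longrightarrow> \<delta> \<le> seminorm n (\<phi> l - y)"
    using J_distance[OF phi_Cinf] l unfolding Z_def by blast
  obtain C where C: "C \<ge> 0" "\<And>x. x \<in> E \<Longrightarrow> seminorm n (G l x) \<le> C * seminorm n x" using seminorm_G by blast
  \<comment> \<open>The first \<open>C\<close> accounts for \<open>G l x\<close>, and
    \<open>C / \<delta>\<close> for the coefficient of \<open>\<phi> l\<close> in
    \<open>S x\<close>.\<close>
  define B where "B = C + C / \<delta> * seminorm n (\<phi> l)"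
  have B0: "B \<ge> 0" using C \<delta> by (simp add: B_def seminorm_nonneg)
  have S_bound: "seminorm n (S x) \<le> B * seminorm n x" if x: "x \<in> J" for x
  proof -
    have E: "x \<in> E" "G l x \<in> E" "S x \<in> E" using x S J_Cinf G_Cinf by auto
    have "D (S x - G l x) = cscale l (S x - G l x)"
      using E by (simp add: D_diff Cinf_imp_dm S x D_G cscale.scale_right_diff_distrib)
    then obtain c where "S x - G l x = cscale c (\<phi> l)"
      using eigenvector[of "S x - G l x" l] E by (metis Cinf_imp_dm csubspace_diff dm_subspace)
    then have c: "S x = G l x + cscale c (\<phi> l)" by (simp add: algebra_simps)
    \<comment> \<open>For nonzero \<open>c\<close> the vector S x / c lies in \<open>J\<close> and
      differs from \<open>\<phi> l\<close> by a multiple of \<open>G l x\<close> of modulus 1 / |c|,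
      so the distance \<open>\<delta>\<close> applies.\<close>
    have "norm c * \<delta> \<le> seminorm n (G l x)"
    proof (rule mult_le_of_le_divide)
      assume "norm c \<noteq> 0"
      then have "c \<noteq> 0" by auto
      then have "\<phi> l - cscale (1 / c) (S x) = cscale (- (1 / c)) (G l x)"
        by (simp add: c cscale_add_right cscale_cscale)
      then have "seminorm n (\<phi> l - cscale (1 / c) (S x)) = seminorm n (G l x) / norm c"
        using E by (simp add: seminorm_cscale norm_divide del: cscale.scale_minus_left)
      then show "\<delta> \<le> seminorm n (G l x) / norm c"
        using \<delta>(2)[of "cscale (1 / c) (S x)"] csubspace_cscale[OF J_subspace] S(1) x by metis
    qed (simp_all add: seminorm_nonneg)
    also have "\<dots> \<le> C * seminorm n x" using C E by blast
    finally have nc: "norm c \<le> C / \<delta> * seminorm n x" using \<delta>(1) by (simp add: field_simps)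
    have "seminorm n (S x) \<le> seminorm n (G l x) + norm c * seminorm n (\<phi> l)"
      unfolding c using seminorm_add[of "G l x" "cscale c (\<phi> l)" n] E
      by (simp add: seminorm_cscale phi_Cinf csubspace_cscale Cinf_subspace)
    also have "\<dots> \<le> C * seminorm n x + C / \<delta> * seminorm n x * seminorm n (\<phi> l)"
      using C E nc by (intro add_mono mult_right_mono) (auto simp: seminorm_nonneg)
    finally show ?thesis by (simp add: B_def algebra_simps)
  qed
  \<comment> \<open>The radius ensures |m - l| B < 1; the added 1 keeps it positive even for B =
    0.\<close>
  have "onto_shift m" if m: "m \<in> ball l (1 / (B + 1))" for m
    unfolding onto_shift_def
  proof
    fix x assume x: "x \<in> J"
    define \<mu> where "\<mu> = m - l"
    define q where "q = norm \<mu> * B"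
    have "norm \<mu> * (B + 1) < 1"
      using m B0 by (simp add: \<mu>_def dist_norm norm_minus_commute pos_less_divide_eq)
    then have q: "0 \<le> q" "q < 1"
      using B0 by (simp_all add: q_def algebra_simps) (smt (verit) norm_ge_zero)
    \<comment> \<open>Neumann iteration. The contraction property is only available in the \<open>n\<close>-th seminorm;
      higher derivatives converge because \<open>D (y (Suc k))\<close> is a combination of \<open>x\<close>, \<open>y k\<close> and \<open>y (Suc k)\<close>.\<close>
    define y where "y k = ((\<lambda>z. S (x + cscale \<mu> z)) ^^ k) 0" for k
    have y_Suc: "y (Suc k) = S (x + cscale \<mu> (y k))" for k by (simp add: y_def)
    have yJ: "y k \<in> J" for k
      by (induction k) (simp_all add: y_Suc, simp_all add: y_def S x csubspace_add csubspace_cscale csubspace_0 J_subspace)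
    have arg: "x + cscale \<mu> (y k) \<in> J" for k
      by (intro csubspace_add csubspace_cscale J_subspace x yJ)
    have yE: "y k \<in> E" for k using yJ J_Cinf by blast
    have dy: "seminorm n (y (Suc k) - y k) \<le> q ^ k * seminorm n (y 1 - y 0)" for k
    proof (induction k)
      case (Suc k)
      have dJ: "y (Suc k) - y k \<in> J" by (intro csubspace_diff J_subspace yJ)
      have "y (Suc (Suc k)) - y (Suc k) = S (cscale \<mu> (y (Suc k) - y k))"
        unfolding y_Suc[of "Suc k"] y_Suc[of k] S_diff[OF arg[of "Suc k", unfolded y_Suc] arg]
        by (simp add: cscale.scale_right_diff_distrib)
      then have "seminorm n (y (Suc (Suc k)) - y (Suc k)) \<le> B * (norm \<mu> * seminorm n (y (Suc k) - y k))"
        using S_bound[OF csubspace_cscale[OF J_subspace dJ, of \<mu>]] seminorm_cscale[OF J_Cinf[OF dJ]] by simp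
      also have "\<dots> \<le> B * (norm \<mu> * (q ^ k * seminorm n (y 1 - y 0)))"
        by (intro mult_left_mono Suc B0) simp
      finally show ?case by (simp add: q_def mult_ac)
    qed simp
    have "convergent (\<lambda>k. (D ^^ j) (y k))" for j
    proof (induction j)
      case low: 0
      have "summable (\<lambda>k. y (Suc k) - y k)"
      proof (rule summable_comparison_test')
        show "summable (\<lambda>k. q ^ k * seminorm n (y 1 - y 0))"
          using q by (intro summable_mult2 summable_geometric) simp
        show "norm (y (Suc k) - y k) \<le> q ^ k * seminorm n (y 1 - y 0)" for k
          using norm_le_seminorm[of 0 n "y (Suc k) - y k"] dy[of k] by simp
      qed
      then have "convergent (\<lambda>k. (\<Sum>i<k. y (Suc i) - y i) + y 0)"
        by (intro convergent_add convergent_const) (simp add: summable_iff_convergent)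
      then show ?case by (simp add: sum_lessThan_telescope)
    next
      case (Suc j)
      then obtain z where z: "(\<lambda>k. (D ^^ j) (y k)) \<longlonglongrightarrow> z" by (auto simp: convergent_def)
      have "(D ^^ Suc j) (y (Suc k)) = (D ^^ j) x + cscale \<mu> ((D ^^ j) (y k)) + cscale l ((D ^^ j) (y (Suc k)))" for k
      proof -
        have "D (y (Suc k)) = (x + cscale \<mu> (y k)) + cscale l (y (Suc k))"
          unfolding y_Suc by (rule S(2)[OF arg])
        then show ?thesis
          using J_Cinf[OF arg[of k]] J_Cinf[OF x] yE
          by (simp add: funpow_swap1 funpow_D_add funpow_D_cscale csubspace_cscale Cinf_subspace)
      qed
      moreover have "(\<lambda>k. (D ^^ j) x + cscale \<mu> ((D ^^ j) (y k)) + cscale l ((D ^^ j) (y (Suc k)))) \<longlonglongrightarrow>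
          (D ^^ j) x + cscale \<mu> z + cscale l z"
        by (intro tendsto_add cscale.tendsto tendsto_const z LIMSEQ_Suc[OF z])
      ultimately have "(\<lambda>k. (D ^^ Suc j) (y (Suc k))) \<longlonglongrightarrow> (D ^^ j) x + cscale \<mu> z + cscale l z"
        by (simp only:)
      then show ?case unfolding convergent_def by (blast intro: LIMSEQ_imp_Suc)
    qed
    then obtain z where z: "Cinf_tendsto y z" using Cinf_complete yE by blast
    have z': "Cinf_tendsto (\<lambda>k. y (Suc k)) z"
      using Cinf_tendsto_subseq[OF z, of Suc] by (simp add: o_def strict_mono_def)
    \<comment> \<open>The limit of the iteration satisfies (D - l) z = x + (m - l) z, which is the
      equation at \<open>m\<close>.\<close>
    have "Cinf_tendsto (\<lambda>k. D (y (Suc k))) (x + cscale \<mu> z + cscale l z)"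
      unfolding y_Suc S(2)[OF arg]
      by (intro Cinf_tendsto_add Cinf_tendsto_cscale Cinf_tendsto_const z z'[unfolded y_Suc] tendsto_const J_Cinf x)
    then have "D z = x + cscale \<mu> z + cscale l z"
      using Cinf_tendsto_D[OF z'] Cinf_tendsto_unique by blast
    then have "D z = x + cscale m z"
      by (simp add: \<mu>_def cscale.scale_left_diff_distrib)
    then show "\<exists>y\<in>J. D y = x + cscale m y" using J_closed[OF z yJ] by blast
  qed
  then show ?thesis using B0 by (intro exI[of _ "1 / (B + 1)"]) auto
qed

text \<open>Solutions at \<open>l k\<close> have the form G (l k) x + c k \<phi> (l k), where all
  but \<open>c k\<close> is known to converge. Since \<open>\<phi> m\<close> keeps a distance from
  \<open>J\<close>, the \<open>c k\<close> are bounded, and a convergent subsequence produces a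
  solution at \<open>m\<close>.\<close>

lemma onto_shift_closed:
  assumes m: "m \<notin> Z" and l: "l \<longlonglongrightarrow> m" and onto: "\<And>k. onto_shift (l k)"
  shows "onto_shift m"
  unfolding onto_shift_def
proof
  fix x assume x: "x \<in> J"
  have "\<forall>k. \<exists>y. y \<in> J \<and> D y = x + cscale (l k) y"
    using onto x unfolding onto_shift_def by blast
  then obtain y where y: "\<And>k. y k \<in> J" "\<And>k. D (y k) = x + cscale (l k) (y k)"
    by metis
  have E: "x \<in> E" "\<And>k. y k \<in> E" "\<And>k. G k x \<in> E"
    by (simp_all add: x y(1) J_Cinf G_Cinf)
  have "\<exists>c. y k = G (l k) x + cscale c (\<phi> (l k))" for k
  proof -
    have "D (y k - G (l k) x) = cscale (l k) (y k - G (l k) x)"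
      using E by (simp add: D_diff Cinf_imp_dm y D_G cscale.scale_right_diff_distrib)
    then obtain c where "y k - G (l k) x = cscale c (\<phi> (l k))"
      using eigenvector[of "y k - G (l k) x" "l k"] E by (metis Cinf_imp_dm csubspace_diff dm_subspace)
    then show ?thesis by (metis diff_add_cancel add.commute)
  qed
  then obtain c where c: "\<And>k. y k = G (l k) x + cscale (c k) (\<phi> (l k))" by metis
  obtain n \<delta> where \<delta>: "\<delta> > 0" "\<And>y. y \<in> J \<Longrightarrow> \<delta> \<le> seminorm n (\<phi> m - y)"
    using J_distance[OF phi_Cinf] m unfolding Z_def by blast
  \<comment> \<open>An eventual bound for \<open>G (l k) x\<close> in seminorm \<open>n\<close>,
    with 1 as tolerance around the limit.\<close>
  define B where "B = seminorm n (G m x) + 1"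
  have "\<forall>\<^sub>F k in sequentially. seminorm n (\<phi> (l k) - \<phi> m) < \<delta> / 2"
    using Cinf_tendsto_seminorm[OF Cinf_tendsto_phi[OF l], of n] \<delta>(1) by (intro order_tendstoD) auto
  moreover have "\<forall>\<^sub>F k in sequentially. seminorm n (G (l k) x - G m x) < 1"
    using Cinf_tendsto_seminorm[OF Cinf_tendsto_G_param[OF l E(1)], of n] by (intro order_tendstoD) auto
  ultimately have "\<forall>\<^sub>F k in sequentially. norm (c k) \<le> B / (\<delta> / 2)"
  proof eventually_elim
    case (elim k)
    have GB: "seminorm n (G (l k) x) \<le> B"
      using seminorm_add[of "G (l k) x - G m x" "G m x" n] elim E
      by (simp add: B_def csubspace_diff Cinf_subspace)
    \<comment> \<open>Half of \<open>\<delta>\<close> is spent on replacing \<open>\<phi> m\<close>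
      by \<open>\<phi> (l k)\<close>; the other half remains to bound \<open>c k\<close>.\<close>
    have "norm (c k) * (\<delta> / 2) \<le> seminorm n (G (l k) x)"
    proof (rule mult_le_of_le_divide)
      assume "norm (c k) \<noteq> 0"
      then have ck: "c k \<noteq> 0" by auto
      then have eq: "\<phi> m - cscale (1 / c k) (y k)
          = cscale (- 1) (\<phi> (l k) - \<phi> m) + cscale (- (1 / c k)) (G (l k) x)"
        by (simp add: c cscale_add_right cscale_cscale)
      have "\<delta> \<le> seminorm n (\<phi> m - cscale (1 / c k) (y k))"
        by (intro \<delta>(2) csubspace_cscale J_subspace y)
      also have "\<dots> \<le> seminorm n (cscale (- 1) (\<phi> (l k) - \<phi> m)) + seminorm n (cscale (- (1 / c k)) (G (l k) x))"
        unfolding eq by (intro seminorm_add csubspace_cscale csubspace_diff Cinf_subspace E phi_Cinf)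
      also have "\<dots> = seminorm n (\<phi> (l k) - \<phi> m) + seminorm n (G (l k) x) / norm (c k)"
        using E by (simp add: seminorm_cscale norm_divide csubspace_diff Cinf_subspace phi_Cinf
            del: cscale.scale_minus_left)
      finally show "\<delta> / 2 \<le> seminorm n (G (l k) x) / norm (c k)" using elim(1) by linarith
    qed (simp_all add: seminorm_nonneg)
    with GB have "norm (c k) * (\<delta> / 2) \<le> B" by simp
    then show ?case using \<delta>(1) by (simp add: pos_le_divide_eq)
  qed
  then have "Bseq c" unfolding Bfun_def using \<delta>(1) 
    by (intro exI[of _ "B / (\<delta> / 2)"]) (auto simp: B_def add_nonneg_pos seminorm_nonneg)
  then obtain c' r where r: "strict_mono r" and c': "(c \<circ> r) \<longlonglongrightarrow> c'"
    using bounded_imp_convergent_subsequence Bseq_eq_bounded by metis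
  define z where "z = G m x + cscale c' (\<phi> m)"
  have lr: "(\<lambda>k. l (r k)) \<longlonglongrightarrow> m" using LIMSEQ_subseq_LIMSEQ[OF l r] by (simp add: o_def)
  have "Cinf_tendsto (\<lambda>k. G (l (r k)) x + cscale (c (r k)) (\<phi> (l (r k)))) z"
    unfolding z_def using c' by (intro Cinf_tendsto_add Cinf_tendsto_cscale Cinf_tendsto_G_param Cinf_tendsto_phi lr E) (simp add: o_def)
  then have "z \<in> J" using J_closed y(1) unfolding c[symmetric] by blast
  moreover have "D z = x + cscale m z"
    by (simp add: z_def D_add G_dm phi_dm csubspace_cscale dm_subspace D_G D_cscale D_phi
        cscale_add_right cscale_cscale mult.commute)
  ultimately show "\<exists>y\<in>J. D y = x + cscale m y" by blast
qed

lemma onto_shift_all: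
  assumes "a \<notin> Z" "onto_shift a" "b \<notin> Z"
  shows "onto_shift b"
proof -
  have "Z sparse_in UNIV" using Z_dichotomy assms(1) by blast
  \<comment> \<open>Deleting a set without limit points leaves the plane connected, so the clopen
    set \<open>?U\<close>, which contains \<open>a\<close>, is all of \<open>- Z\<close>.\<close>
  then have conn: "connected (- Z)"
    using sparse_imp_connected[of "UNIV :: complex set" Z] by (simp add: Compl_eq_Diff_UNIV connected_UNIV)
  let ?U = "{l \<in> - Z. onto_shift l}"
  have "openin (top_of_set (- Z)) ?U"
    unfolding openin_euclidean_subtopology_iff
  proof (intro conjI ballI)
    fix l assume "l \<in> ?U"
    then obtain e where "e > 0" "\<forall>m\<in>ball l e. onto_shift m" using onto_shift_open by blast
    then show "\<exists>e>0. \<forall>m\<in>- Z. dist m l < e \<longrightarrow> m \<in> ?U"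
      by (intro exI[of _ e]) (auto simp: dist_commute)
  qed auto
  moreover have "closedin (top_of_set (- Z)) ?U"
    unfolding closedin_limpt islimpt_sequential using onto_shift_closed by fastforce
  ultimately have "?U = {} \<or> ?U = - Z" using conn unfolding connected_clopen by blast
  then show ?thesis using assms by blast
qed

section \<open>The spectrum and the kernels\<close>

lemma notin_restr_spectrum: "l \<notin> restr_spectrum D J \<longleftrightarrow> l \<notin> Z \<and> onto_shift l"
proof
  assume "l \<notin> restr_spectrum D J"
  then have bij: "bij_betw (\<lambda>x. D x - cscale l x) J J" by (simp add: restr_spectrum_def)
  have "\<phi> l \<notin> J"
  proof
    assume "\<phi> l \<in> J"
    then have "\<phi> l = 0"
      using inj_onD[OF bij_betw_imp_inj_on[OF bij], of "\<phi> l" 0] csubspace_0[OF J_subspace]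
      by (simp add: D_phi D_0)
    then show False using phi_neq_0 by simp
  qed
  moreover have "onto_shift l"
    unfolding onto_shift_def
  proof
    fix x assume "x \<in> J"
    then have "x \<in> (\<lambda>x. D x - cscale l x) ` J" using bij_betw_imp_surj_on[OF bij] by simp
    then obtain y where "y \<in> J" "x = D y - cscale l y" by blast
    then show "\<exists>y\<in>J. D y = x + cscale l y" by (intro bexI[of _ y]) simp_all
  qed
  ultimately show "l \<notin> Z \<and> onto_shift l" by (simp add: Z_def)
next
  assume l: "l \<notin> Z \<and> onto_shift l"
  have "inj_on (\<lambda>x. D x - cscale l x) J"
  proof
    fix x y assume xy: "x \<in> J" "y \<in> J" "D x - cscale l x = D y - cscale l y"
    have "x - y = 0"
    proof (rule kernel_trivial)
      show "l \<notin> Z" using l by blast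
      show "x - y \<in> J" using xy by (simp add: csubspace_diff J_subspace)
      show "D (x - y) = cscale l (x - y)"
        using xy by (simp add: D_diff Cinf_imp_dm J_Cinf cscale.scale_right_diff_distrib algebra_simps)
    qed
    then show "x = y" by simp
  qed
  moreover have "(\<lambda>x. D x - cscale l x) ` J = J"
  proof (intro equalityI subsetI)
    fix x assume "x \<in> J"
    then obtain y where "y \<in> J" "D y = x + cscale l y" using l unfolding onto_shift_def by blast
    then show "x \<in> (\<lambda>x. D x - cscale l x) ` J" by (intro image_eqI[of _ _ y]) auto
  qed (auto intro!: csubspace_diff csubspace_cscale J_subspace J_D)
  ultimately show "l \<notin> restr_spectrum D J" by (simp add: restr_spectrum_def bij_betw_def)
qed

text \<open>One point outside the spectrum spreads surjectivity over the whole complement of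
  \<open>Z\<close>; failure of injectivity, that is membership in \<open>Z\<close>, is then the only
  obstruction.\<close>

lemma restr_spectrum_eq_Z:
  assumes "restr_spectrum D J \<noteq> UNIV"
  shows "restr_spectrum D J = Z"
proof -
  obtain a where "a \<notin> Z" "onto_shift a" using assms notin_restr_spectrum by blast
  then show ?thesis using notin_restr_spectrum onto_shift_all by blast
qed

lemma discrete_Z: "Z \<noteq> UNIV \<Longrightarrow> discrete Z"
  using Z_dichotomy unfolding discrete_def isolated_in_islimpt_iff sparse_in_def by blast

lemma restr_kernel_eq:
  assumes "l \<in> Z" shows "restr_kernel D J l = cspan1 (\<phi> l)"
proof (intro equalityI subsetI)
  fix x assume "x \<in> restr_kernel D J l"
  then have "x \<in> J" "D x = cscale l x" by (auto simp: restr_kernel_def)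
  then show "x \<in> cspan1 (\<phi> l)"
    using eigenvector[of x l] Cinf_imp_dm[OF J_Cinf] unfolding cspan1_def by blast
next
  fix x assume "x \<in> cspan1 (\<phi> l)"
  then show "x \<in> restr_kernel D J l"
    using assms by (auto simp: cspan1_def restr_kernel_def Z_def D_cscale phi_dm D_phi
        csubspace_cscale J_subspace cscale_cscale mult.commute)
qed

end

theorem theorem6p4:
  fixes dm :: "'a::complex_hilbert set" and D V :: "'a \<Rightarrow> 'a"
    and \<phi>0 :: 'a and J :: "'a set"
  assumes "separable_type TYPE('a)"
    and "admissible dm D V"
    and "\<phi>0 \<in> opker dm D" and "\<phi>0 \<noteq> 0"
    and "closed_invariant_subspace dm D J"
  shows "(restr_spectrum D J = UNIV \<or>
          (restr_spectrum D J = {l. phi V \<phi>0 l \<in> J} \<and> discrete {l. phi V \<phi>0 l \<in> J}))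
       \<and> (restr_spectrum D J \<noteq> UNIV \<and> restr_spectrum D J \<noteq> {} \<longrightarrow>
          (\<forall>l\<in>restr_spectrum D J.
              phi V \<phi>0 l \<noteq> 0 \<and> restr_kernel D J l = cspan1 (phi V \<phi>0 l)))"
proof -
  interpret admissible_pair dm D V \<phi>0 by unfold_locales fact+
  interpret admissible_subspace dm D V \<phi>0 J by unfold_locales fact
  show ?thesis
    using restr_spectrum_eq_Z discrete_Z restr_kernel_eq phi_neq_0 unfolding Z_def by metis
qed

end
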